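(* For any integers $n_1,n_2$ with $2\le n_1<n_2$, $$\left\lfloor\frac{n_1+n_2-2}{n_1-1}\right\rfloor\le \dim(P_{n_1}\boxtimes P_{n_2})\le\left\lceil\frac{n_1+n_2-2}{n_1-1}\right\rceil.$$
   Context: $P_n$ is the path of order $n$. A set $S\subseteq V(G)$ of a connected graph $G$ is a metric generator if for every two distinct vertices $x,y$ there is $s\in S$ with $d_G(s,x)\ne d_G(s,y)$ (shortest-path distance); $\dim(G)$ is the minimum cardinality of a metric generator. The strong product $G\boxtimes H$ has vertex set $V(G)\times V(H)$, with $(a,b)$ and $(c,d)$ adjacent iff ($a=c$ and $bd\in E(H)$) or ($b=d$ and $ac\in E(G)$) or ($ac\in E(G)$ and $bd\in E(H)$). *)

theory Defs
  imports Complex_Main "Graph_Theory.Graph_Theory"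
begin

text \<open>
  A finite simple graph is represented by a symmetric loop-free digraph without parallel arcs
  (locale \<^locale>\<open>graph\<close>, or \<^locale>\<open>pair_graph\<close> for arcs given as vertex pairs): the undirected
  edge uv corresponds to the two arcs (u,v) and (v,u).
\<close>

definition path_graph :: "nat \<Rightarrow> nat pair_pre_digraph" where
  "path_graph n =
     \<lparr> pverts = {0..<n},
       parcs = {(i, j). i < n \<and> j < n \<and> (j = Suc i \<or> i = Suc j)} \<rparr>"

definition strong_product ::
    "'a pair_pre_digraph \<Rightarrow> 'b pair_pre_digraph \<Rightarrow> ('a \<times> 'b) pair_pre_digraph"
    (infixl \<open>\<boxtimes>\<close> 70) where
  "G \<boxtimes> H =
     \<lparr> pverts = pverts G \<times> pverts H,
       parcs = {((a, b), (c, d)).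
         (a, b) \<in> pverts G \<times> pverts H \<and> (c, d) \<in> pverts G \<times> pverts H \<and>
         ((a = c \<and> (b, d) \<in> parcs H) \<or>
          (b = d \<and> (a, c) \<in> parcs G) \<or>
          ((a, c) \<in> parcs G \<and> (b, d) \<in> parcs H))} \<rparr>"

text \<open>
  The constant \<^const>\<open>wf_digraph.\<mu>\<close> is the minimum cost of a walk; with unit costs this is the
  minimum number of edges.
\<close>

definition graph_dist :: "('a, 'b) pre_digraph \<Rightarrow> 'a \<Rightarrow> 'a \<Rightarrow> ereal" where
  "graph_dist G u v = wf_digraph.\<mu> G (\<lambda>_. 1) u v"

definition metric_generator :: "('a, 'b) pre_digraph \<Rightarrow> 'a set \<Rightarrow> bool" where
  "metric_generator G S \<longleftrightarrow>
     S \<subseteq> verts G \<and>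
     (\<forall>x\<in>verts G. \<forall>y\<in>verts G. x \<noteq> y \<longrightarrow> (\<exists>s\<in>S. graph_dist G s x \<noteq> graph_dist G s y))"

text \<open>
  The set of cardinalities is nonempty for every finite \<open>G\<close>, since \<^term>\<open>verts G\<close> is a metric
  generator.
\<close>

definition metric_dim :: "('a, 'b) pre_digraph \<Rightarrow> nat" where
  "metric_dim G = (LEAST k. \<exists>S. metric_generator G S \<and> finite S \<and> card S = k)"

lemma pair_graph_path_graph: "pair_graph (path_graph n)"
proof
  show "finite (parcs (path_graph n))"
    by (rule finite_subset[of _ "{0..<n} \<times> {0..<n}"]) (auto simp: path_graph_def)
qed (auto simp: path_graph_def arcs_ends_def arc_to_ends_def symmetric_def intro!: symI)

lemma pair_graph_strong_product:
  assumes "pair_graph G" "pair_graph H"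
  shows "pair_graph (G \<boxtimes> H)"
proof -
  interpret G: pair_graph G by fact
  interpret H: pair_graph H by fact
  show ?thesis
  proof
    show "finite (pverts (G \<boxtimes> H))"
      by (simp add: strong_product_def)
    show "finite (parcs (G \<boxtimes> H))"
      by (rule finite_subset[of _ "(pverts G \<times> pverts H) \<times> (pverts G \<times> pverts H)"])
        (auto simp: strong_product_def)
    show "symmetric (with_proj (G \<boxtimes> H))"
      using G.arcs_symmetric H.arcs_symmetric
      by (auto simp: strong_product_def symmetric_def arcs_ends_def arc_to_ends_def
          intro!: symI)
  qed (auto simp: strong_product_def dest: G.no_loops H.no_loops)
qed

end

theory Submission
  imports Defs
begin

text \<open>
  Distances in the strong product of two paths are Chebyshev distances on a grid
  \<open>{0..m} \<times> {0..N}\<close>, where \<open>m = n\<^sub>1 - 1\<close> and \<open>N = n\<^sub>2 - 1\<close>.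

  Lower bound: in each of the \<open>N + 1\<close> rows the two leftmost and the two rightmost vertices must
  be resolved, and a single vertex resolves at most \<open>2m\<close> of these \<open>2(N + 1)\<close> pairs. Hence a metric
  generator \<open>S\<close> satisfies \<open>N + 1 \<le> m |S|\<close>.

  Upper bound: the zigzag \<open>(0,0), (m,m), (0,2m), (m,3m), \<dots>\<close>, with the second coordinate cut off
  at \<open>N\<close>, is a metric generator. Two vertices in the same row are resolved by one of the two zigzag
  points bracketing that row; two vertices in different rows that the first two points fail to
  resolve are mirror images in the diagonal, and the third point resolves those.
\<close>

section \<open>Distances in the strong product\<close>

definition chebyshev :: "nat \<times> nat \<Rightarrow> nat \<times> nat \<Rightarrow> int" where
  "chebyshev p q = max \<bar>int (fst p) - int (fst q)\<bar> \<bar>int (snd p) - int (snd q)\<bar>"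

lemma pverts_grid: "pverts (path_graph k \<boxtimes> path_graph l) = {..<k} \<times> {..<l}"
  by (auto simp: strong_product_def path_graph_def)

lemma parcs_grid_iff:
  "(p, q) \<in> parcs (path_graph k \<boxtimes> path_graph l) \<longleftrightarrow>
     p \<in> {..<k} \<times> {..<l} \<and> q \<in> {..<k} \<times> {..<l} \<and> chebyshev p q = 1"
  by (cases p; cases q) (auto simp: strong_product_def path_graph_def chebyshev_def)

text \<open>Replaces the infimum of extended real walk costs by bounds on walk lengths in
  \<open>nat\<close>: the witness walk attains the infimum.\<close>

lemma (in wf_digraph) graph_dist_eqI:
  assumes lower: "\<And>p. awalk u p v \<Longrightarrow> d \<le> length p"
    and walk: "awalk u p v" "length p = d"
  shows "graph_dist G u v = ereal (real d)"
proof -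
  have cost: "awalk_cost (\<lambda>_. 1) p = real (length p)" for p
    by (induction p) auto
  show ?thesis
    unfolding graph_dist_def \<mu>_def cost
  proof (rule antisym)
    show "(INF p\<in>{p. awalk u p v}. ereal (real (length p))) \<le> ereal (real d)"
      using walk by (intro INF_lower2[of p]) auto
    show "ereal (real d) \<le> (INF p\<in>{p. awalk u p v}. ereal (real (length p)))"
      by (intro INF_greatest) (use lower in auto)
  qed
qed

lemma chebyshev_triangle: "chebyshev p r \<le> chebyshev p q + chebyshev q r"
  unfolding chebyshev_def by linarith

lemma graph_dist_grid:
  assumes "u \<in> {..<k} \<times> {..<l}" "v \<in> {..<k} \<times> {..<l}"
  shows "graph_dist (with_proj (path_graph k \<boxtimes> path_graph l)) u v
           = ereal (real_of_int (chebyshev u v))"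
proof -
  let ?G = "path_graph k \<boxtimes> path_graph l"
  interpret G: pair_graph ?G
    by (intro pair_graph_strong_product pair_graph_path_graph)
  have lower: "chebyshev u v \<le> int (length p)" if "G.awalk u p v" for p u
    using that
  proof (induction p arbitrary: u)
    case Nil
    then show ?case by (simp add: G.awalk_Nil_iff chebyshev_def)
  next
    case (Cons e p)
    then have arc: "(fst e, snd e) \<in> parcs ?G" "u = fst e" and walk: "G.awalk (snd e) p v"
      by (auto simp: G.awalk_Cons_iff)
    from arc have "chebyshev u (snd e) = 1"
      unfolding parcs_grid_iff by simp
    with Cons.IH[OF walk] show ?case
      using chebyshev_triangle[of u v "snd e"] by simp
  qed
  have walk: "\<exists>p. G.awalk u p v \<and> length p = d"
    if "u \<in> {..<k} \<times> {..<l}" "chebyshev u v = int d" for u d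
    using that
  proof (induction d arbitrary: u)
    case 0
    then have "u = v" by (auto simp: chebyshev_def prod_eq_iff)
    with 0 have "G.awalk u [] v" by (auto simp: G.awalk_Nil_iff pverts_grid)
    then show ?case by auto
  next
    case (Suc d)
    \<comment> \<open>Like a chess king, move every coordinate that differs from that of
      \<open>v\<close> by one towards it. All nonzero differences drop by one, hence so does their
      maximum.\<close>
    define step :: "nat \<Rightarrow> nat \<Rightarrow> nat"
      where "step a b = (if a < b then Suc a else if b < a then a - 1 else a)" for a b
    define w where "w = (step (fst u) (fst v), step (snd u) (snd v))"
    have w: "w \<in> {..<k} \<times> {..<l}" "chebyshev u w = 1" "chebyshev w v = int d"
      using Suc.prems assms(2)
      by (auto simp: w_def step_def chebyshev_def max_def split: if_splits)
    from Suc.IH[OF w(1,3)] obtain p where p: "G.awalk w p v" "length p = d" by blast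
    have "(u, w) \<in> parcs ?G" using Suc.prems w by (simp add: parcs_grid_iff)
    with p have "G.awalk u ((u, w) # p) v" by (simp add: G.awalk_Cons_iff)
    with p show ?case by (intro exI[of _ "(u, w) # p"]) simp
  qed
  have "0 \<le> chebyshev u v" unfolding chebyshev_def by linarith
  then have nonneg: "chebyshev u v = int (nat (chebyshev u v))" by simp
  obtain p where "G.awalk u p v" "length p = nat (chebyshev u v)"
    using walk[OF assms(1) nonneg] by blast
  then have "graph_dist (with_proj ?G) u v = ereal (real (nat (chebyshev u v)))"
    using lower[of u] by (intro G.graph_dist_eqI[of _ _ _ p]) (auto simp: nat_le_iff)
  then show ?thesis using \<open>0 \<le> chebyshev u v\<close> by simp
qed

text \<open>Removes graphs and extended reals; from here on everything is integer
  arithmetic.\<close>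

lemma metric_generator_grid_iff:
  "metric_generator (with_proj (path_graph k \<boxtimes> path_graph l)) S \<longleftrightarrow>
     S \<subseteq> {..<k} \<times> {..<l} \<and>
     (\<forall>p\<in>{..<k} \<times> {..<l}. \<forall>q\<in>{..<k} \<times> {..<l}. p \<noteq> q \<longrightarrow>
        (\<exists>s\<in>S. chebyshev s p \<noteq> chebyshev s q))"
proof -
  have *: "graph_dist (with_proj (path_graph k \<boxtimes> path_graph l)) s p =
          graph_dist (with_proj (path_graph k \<boxtimes> path_graph l)) s q \<longleftrightarrow>
        chebyshev s p = chebyshev s q"
    if "s \<in> {..<k} \<times> {..<l}" "p \<in> {..<k} \<times> {..<l}" "q \<in> {..<k} \<times> {..<l}" for s p q
    by (simp only: graph_dist_grid[OF that(1,2)] graph_dist_grid[OF that(1,3)]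
        ereal.inject of_int_eq_iff)
  show ?thesis
    unfolding metric_generator_def with_proj_simps pverts_grid
    by (intro conj_cong ball_cong imp_cong bex_cong refl) (simp add: * subsetD)
qed

section \<open>Lower bound by counting resolved pairs\<close>

lemma card_nat_ball_le:
  fixes c r :: nat
  assumes "A \<subseteq> {y. \<bar>int c - int y\<bar> < int r}"
  shows "card A \<le> 2 * r - 1"
proof -
  \<comment> \<open>Truncation of \<open>c + 1 - r\<close> at 0 only shortens the interval; for
    \<open>r = 0\<close> it is empty, matching \<open>2 * r - 1 = 0\<close>.\<close>
  have "A \<subseteq> {c + 1 - r..<c + r}" using assms by force
  from card_mono[OF _ this] have "card A \<le> (c + r) - (c + 1 - r)" by simp
  then show ?thesis by linarith
qed

text \<open>A pair in row \<open>y\<close> is resolved only if \<open>\<bar>c - y\<bar>\<close> is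
  below the larger of the two horizontal distances, since otherwise the vertical distance decides
  both maxima. That larger distance is \<open>max 1 a\<close> on the left and
  \<open>max 1 (m - a)\<close> on the right.\<close>

lemma card_edge_pairs_le:
  assumes "1 \<le> m" "a \<le> m"
  shows "card {y. y \<le> N \<and> chebyshev (a, c) (0, y) \<noteq> chebyshev (a, c) (1, y)}
       + card {y. y \<le> N \<and> chebyshev (a, c) (m - 1, y) \<noteq> chebyshev (a, c) (m, y)} \<le> 2 * m"
    (is "card ?A + card ?B \<le> _")
proof -
  have "?A \<subseteq> {y. \<bar>int c - int y\<bar> < int (max 1 a)}"
    by (auto simp: chebyshev_def max_def split: if_splits)
  then have "card ?A \<le> 2 * max 1 a - 1" by (rule card_nat_ball_le)
  moreover have "?B \<subseteq> {y. \<bar>int c - int y\<bar> < int (max 1 (m - a))}"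
    using assms by (auto simp: chebyshev_def max_def of_nat_diff split: if_splits)
  then have "card ?B \<le> 2 * max 1 (m - a) - 1" by (rule card_nat_ball_le)
  \<comment> \<open>The two bounds add up to \<open>2 * m\<close> for \<open>a = 0\<close> and
    \<open>a = m\<close>, and to \<open>2 * m - 2\<close> in between.\<close>
  ultimately show ?thesis using assms by (auto simp: max_def split: if_splits)
qed

lemma grid_generator_card_ge:
  assumes "1 \<le> m" "finite S"
    and gen: "metric_generator (with_proj (path_graph (Suc m) \<boxtimes> path_graph (Suc N))) S"
  shows "N + 1 \<le> m * card S"
proof -
  define R where "R i s = {y. y \<le> N \<and> chebyshev s (i, y) \<noteq> chebyshev s (Suc i, y)}" for i s
  have cover: "N + 1 \<le> (\<Sum>s\<in>S. card (R i s))" if "i < m" for i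
  proof -
    have "{..N} \<subseteq> (\<Union>s\<in>S. R i s)"
    proof
      fix y assume "y \<in> {..N}"
      then have "(i, y) \<in> {..<Suc m} \<times> {..<Suc N}" "(Suc i, y) \<in> {..<Suc m} \<times> {..<Suc N}"
        using that by auto
      then have "\<exists>s\<in>S. chebyshev s (i, y) \<noteq> chebyshev s (Suc i, y)"
        using gen unfolding metric_generator_grid_iff by (metis n_not_Suc_n prod.inject)
      then show "y \<in> (\<Union>s\<in>S. R i s)" using \<open>y \<in> {..N}\<close> by (auto simp: R_def)
    qed
    moreover have "finite (\<Union>s\<in>S. R i s)"
      using \<open>finite S\<close> by (auto simp: R_def)
    ultimately have "card {..N} \<le> card (\<Union>s\<in>S. R i s)" by (intro card_mono)
    also have "\<dots> \<le> (\<Sum>s\<in>S. card (R i s))" by (rule card_UN_le[OF \<open>finite S\<close>])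
    finally show ?thesis by simp
  qed
  have "card (R 0 s) + card (R (m - 1) s) \<le> 2 * m" if "s \<in> S" for s
  proof -
    from that gen have "fst s \<le> m" unfolding metric_generator_grid_iff by force
    from card_edge_pairs_le[OF \<open>1 \<le> m\<close> this, of N "snd s"] show ?thesis
      using \<open>1 \<le> m\<close> by (simp add: R_def)
  qed
  then have "(\<Sum>s\<in>S. card (R 0 s) + card (R (m - 1) s)) \<le> (\<Sum>s\<in>S. 2 * m)"
    by (rule sum_mono)
  then have "(\<Sum>s\<in>S. card (R 0 s)) + (\<Sum>s\<in>S. card (R (m - 1) s)) \<le> 2 * (m * card S)"
    by (simp add: sum.distrib mult_ac)
  \<comment> \<open>The two covers together need \<open>2 * (N + 1)\<close> resolutions. For
    \<open>m = 1\<close> both are the same cover, counted twice on either side.\<close>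
  with cover[of 0] cover[of "m - 1"] \<open>1 \<le> m\<close> show ?thesis by linarith
qed

section \<open>Upper bound by the zigzag\<close>

definition zigzag :: "nat \<Rightarrow> nat \<Rightarrow> nat \<Rightarrow> nat \<times> nat" where
  "zigzag m N i = (if even i then 0 else m, min (i * m) N)"

text \<open>The two points lie in opposite columns, at vertical distances \<open>d\<close> and
  \<open>d'\<close> from the row with \<open>d + d' \<le> m\<close>. For even \<open>i\<close>,
  failing to resolve means \<open>x' \<le> d\<close> and \<open>m - x \<le> d'\<close>, so
  \<open>x' \<le> x\<close>; for odd \<open>i\<close>, \<open>d\<close> and \<open>d'\<close>
  swap.\<close>

lemma zigzag_resolves_same_row:
  assumes "x < x'" "x' \<le> m" "i * m \<le> y" "y \<le> Suc i * m" "y \<le> N"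
    and eq0: "chebyshev (zigzag m N i) (x, y) = chebyshev (zigzag m N i) (x', y)"
    and eq1: "chebyshev (zigzag m N (Suc i)) (x, y) = chebyshev (zigzag m N (Suc i)) (x', y)"
  shows False
proof -
  \<comment> \<open>As \<open>i * m \<le> y \<le> N\<close>, the lower point is not cut off, and
    cutting the upper one keeps it at or above row \<open>y\<close>.\<close>
  obtain c c' where c: "c = i * m" "c' = min (Suc i * m) N" "c \<le> y" "y \<le> c'" "c' \<le> c + m"
    using assms by auto
  have z: "zigzag m N i = (if even i then 0 else m, c)"
      "zigzag m N (Suc i) = (if even i then m else 0, c')"
    using c assms by (auto simp: zigzag_def)
  show False
    using eq0 eq1 c(3-) assms(1,2) unfolding z
    by (auto simp: chebyshev_def max_def split: if_splits)
qed

lemma zigzag_resolves_rows: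
  assumes "m < N" "x \<le> m" "x' \<le> m" "y < y'"
    and eq0: "chebyshev (zigzag m N 0) (x, y) = chebyshev (zigzag m N 0) (x', y')"
    and eq1: "chebyshev (zigzag m N 1) (x, y) = chebyshev (zigzag m N 1) (x', y')"
    and eq2: "chebyshev (zigzag m N 2) (x, y) = chebyshev (zigzag m N 2) (x', y')"
  shows False
proof -
  obtain c where c: "c = min (2 * m) N" "m < c \<or> m = 0"
    using \<open>m < N\<close> by auto
  have z: "zigzag m N 0 = (0, 0)" "zigzag m N 1 = (m, m)" "zigzag m N 2 = (0, c)"
    using assms(1) c by (auto simp: zigzag_def)
  have "max (int x) (int y) = max (int x') (int y')"
    using eq0 unfolding z by (simp add: chebyshev_def)
  \<comment> \<open>If \<open>x < y'\<close>, the left maximum would be below \<open>y'\<close>.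
    Hence \<open>y < y' \<le> x \<le> m\<close>, so \<open>(m, m)\<close> measures \<open>m\<close>
    minus the smaller coordinate. The points thus agree in maximum and minimum of their coordinates,
    and \<open>y < y'\<close> leaves only the mirror image.\<close>
  with assms have "x \<ge> y'" by linarith
  moreover from this have "max (int m - int x) (int m - int y) = max (int m - int x') (int m - int y')"
    using eq1 assms unfolding z by (simp add: chebyshev_def)
  ultimately have "x = y'" "x' = y"
    using assms(2-4) \<open>max (int x) (int y) = max (int x') (int y')\<close> by linarith+
  \<comment> \<open>Now \<open>y < x \<le> m < c\<close>, so both entries of
    \<open>max x (c - y)\<close> exceed those of \<open>max y (c - x)\<close>.\<close>
  with eq2 c(2) assms(2-4) show False
    unfolding z by (auto simp: chebyshev_def)
qed

text \<open>By \<open>N \<le> K * m\<close> the zigzag reaches row \<open>N\<close>, so consecutive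
  points bracket every row; \<open>m < N\<close> forces \<open>2 \<le> K\<close>, so the third point
  is available.\<close>

lemma zigzag_metric_generator:
  assumes "1 \<le> m" "m < N" "N \<le> K * m"
  shows "metric_generator (with_proj (path_graph (Suc m) \<boxtimes> path_graph (Suc N)))
           (zigzag m N ` {..K})"
proof -
  let ?Z = "zigzag m N ` {..K}"
  have "2 \<le> K"
  proof (rule ccontr)
    assume "\<not> 2 \<le> K"
    then have "K * m \<le> 1 * m" by (intro mult_right_mono) auto
    with assms show False by linarith
  qed
  have same_row: "\<exists>s\<in>?Z. chebyshev s (x, y) \<noteq> chebyshev s (x', y)"
    if "x < x'" "x' \<le> m" "y \<le> N" for x x' y
  proof -
    obtain i where i: "i < K" "i * m \<le> y" "y \<le> Suc i * m"
    proof (cases "y = 0")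
      case True
      with that \<open>2 \<le> K\<close> show thesis by (intro that[of 0]) auto
    next
      case False
      \<comment> \<open>Dividing \<open>y - 1\<close> rather than \<open>y\<close> keeps the index
        below \<open>K\<close> even when \<open>y = K * m\<close>.\<close>
      let ?i = "(y - 1) div m"
      have "y - 1 < K * m" using False \<open>y \<le> N\<close> assms by linarith
      then have "?i < K" using assms by (simp add: less_mult_imp_div_less)
      moreover have "?i * m \<le> y - 1" by simp
      moreover have "y - 1 < Suc ?i * m"
        using assms dividend_less_div_times[of m "y - 1"] by simp
      ultimately show thesis using False by (intro that[of ?i]) linarith+
    qed
    then have "zigzag m N i \<in> ?Z" "zigzag m N (Suc i) \<in> ?Z" by auto
    with zigzag_resolves_same_row[OF that(1,2) i(2,3) that(3)] show ?thesis by blast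
  qed
  have rows: "\<exists>s\<in>?Z. chebyshev s (x, y) \<noteq> chebyshev s (x', y')"
    if "x \<le> m" "x' \<le> m" "y < y'" for x x' y y'
  proof -
    have "zigzag m N 0 \<in> ?Z" "zigzag m N 1 \<in> ?Z" "zigzag m N 2 \<in> ?Z"
      using \<open>2 \<le> K\<close> by auto
    with zigzag_resolves_rows[OF assms(2) that] show ?thesis by blast
  qed
  have "\<exists>s\<in>?Z. chebyshev s (x, y) \<noteq> chebyshev s (x', y')"
    if "x \<le> m" "y \<le> N" "x' \<le> m" "y' \<le> N" "(x, y) \<noteq> (x', y')" for x y x' y'
  proof (cases y y' rule: linorder_cases)
    case less
    with rows that show ?thesis by blast
  next
    case greater
    with rows[of x' x y' y] that show ?thesis by metis
  next
    case equal
    with that have "x < x' \<or> x' < x" by auto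
    with same_row[of x x' y] same_row[of x' x y] equal that show ?thesis by metis
  qed
  moreover have "?Z \<subseteq> {..<Suc m} \<times> {..<Suc N}" by (auto simp: zigzag_def)
  ultimately show ?thesis
    unfolding metric_generator_grid_iff by (auto simp: less_Suc_eq_le)
qed

section \<open>The dimension as a minimum, and both bounds\<close>

lemma metric_dim_le:
  assumes "metric_generator G S" "finite S"
  shows "metric_dim G \<le> card S"
  unfolding metric_dim_def by (rule Least_le) (use assms in blast)

lemma metric_dim_attained:
  assumes "metric_generator G S" "finite S"
  obtains T where "metric_generator G T" "finite T" "card T = metric_dim G"
  using LeastI[of "\<lambda>k. \<exists>S. metric_generator G S \<and> finite S \<and> card S = k" "card S"] assms
  unfolding metric_dim_def by blast

theorem theorem5:
  fixes n\<^sub>1 n\<^sub>2 :: nat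
  assumes "2 \<le> n\<^sub>1" and "n\<^sub>1 < n\<^sub>2"
  shows "\<lfloor>(real n\<^sub>1 + real n\<^sub>2 - 2) / (real n\<^sub>1 - 1)\<rfloor>
           \<le> int (metric_dim (with_proj (path_graph n\<^sub>1 \<boxtimes> path_graph n\<^sub>2)))
       \<and> int (metric_dim (with_proj (path_graph n\<^sub>1 \<boxtimes> path_graph n\<^sub>2)))
           \<le> \<lceil>(real n\<^sub>1 + real n\<^sub>2 - 2) / (real n\<^sub>1 - 1)\<rceil>"
proof -
  obtain m N where mN: "n\<^sub>1 = Suc m" "n\<^sub>2 = Suc N" "1 \<le> m" "m < N"
    using assms by (cases n\<^sub>1; cases n\<^sub>2) auto
  let ?G = "with_proj (path_graph (Suc m) \<boxtimes> path_graph (Suc N))"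
  have quotient: "(real n\<^sub>1 + real n\<^sub>2 - 2) / (real n\<^sub>1 - 1) = real N / real m + 1"
    using mN by (simp add: field_simps)
  \<comment> \<open>The least \<open>K\<close> with \<open>N \<le> K * m\<close>; the indices
    \<open>0\<close> to \<open>K\<close> give at most \<open>K + 1\<close> points, which is the
    claimed ceiling.\<close>
  define K where "K = nat \<lceil>real N / real m\<rceil>"
  have "0 \<le> real N / real m" by simp
  then have ceil: "int K = \<lceil>real N / real m\<rceil>"
    unfolding K_def by linarith
  have "real N / real m \<le> real K" unfolding K_def by (rule real_nat_ceiling_ge)
  then have "real N \<le> real (K * m)" using mN by (simp add: field_simps)
  then have "N \<le> K * m" by (simp only: of_nat_le_iff)
  then have gen: "metric_generator ?G (zigzag m N ` {..K})"
    using mN by (intro zigzag_metric_generator) auto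
  have "metric_dim ?G \<le> card (zigzag m N ` {..K})"
    using gen by (rule metric_dim_le) simp
  also have "\<dots> \<le> K + 1" using card_image_le[of "{..K}" "zigzag m N"] by simp
  finally have upper: "int (metric_dim ?G) \<le> \<lceil>real N / real m + 1\<rceil>"
    using ceil by simp
  obtain T where T: "metric_generator ?G T" "finite T" "card T = metric_dim ?G"
    using metric_dim_attained[OF gen] by auto
  have "N + 1 \<le> m * metric_dim ?G"
    using grid_generator_card_ge[OF mN(3) T(2,1)] T(3) by simp
  then have "real (N + 1) \<le> real (m * metric_dim ?G)" by (simp only: of_nat_le_iff)
  \<comment> \<open>Strictness, gained from the \<open>+ 1\<close> in \<open>N + 1\<close>, yields
    the summand 1 inside the floor.\<close>
  then have "real N / real m < real (metric_dim ?G)"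
    using mN by (simp add: field_simps)
  then have "\<lfloor>real N / real m + 1\<rfloor> \<le> int (metric_dim ?G)"
    by linarith
  with upper show ?thesis unfolding quotient unfolding mN(1,2) by blast
qed

end
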